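(* Let $G=([q],E)$ be a tournament graph and let $\boldsymbol{r}\in\mathsf{R}$ be a candidate ranking without ties. Assume the pairwise-interaction data generating process described in the context (with link function in $\mathbf{F}$). For any $\alpha\in(0,1)$, the test $\phi^{FS}_\alpha(\boldsymbol{Y}_{\boldsymbol{n}})=I\{\pi_{\Lambda(\hat{\boldsymbol{p}})}\le\alpha\}$ is finite-sample valid: $$\mathbb{E}_P\big[\phi^{FS}_\alpha(\boldsymbol{Y}_{\boldsymbol{n}})\big]\le\alpha\qquad\text{for all }P\in\boldsymbol{P}_0(\boldsymbol{r})\text{ and all }\boldsymbol{n}=(n_{\ell,k})_{(\ell,k)\in E}\text{ of positive integers}.$$
   Context: **Model.** $[q]=\{1,\dots,q\}$ is a set of teams; $\mathsf{R}=\{\boldsymbol{r}\in\mathbb{N}^q:\ r_\ell=1+\sum_{k}I\{r_k<r_\ell\}\ \forall\ell\}$ is the set of possible rankings ($r_\ell=1$ is best). $G=([q],E)$ is a simple undirected graph; $E$ is the set of unordered pairs of teams that interact. For each $(\ell,k)\in E$ one observes $Y_{\ell,k,i}\in\{0,1\}$, $i=1,\dots,n_{\ell,k}$ (win of $\ell$ over $k$), with $Y_{k,\ell,i}=1-Y_{\ell,k,i}$; all $Y_{\ell,k,i}$ are mutually independent, and Bernoulli with success probability $p_{\ell,k}$ (so $p_{k,\ell}=1-p_{\ell,k}$). $G$ and $\boldsymbol{n}$ are fixed. $\boldsymbol{Y}_{\boldsymbol{n}}$ is the whole sample. In the model, $p_{\ell,k}=F_0(\theta_{0,\ell},\theta_{0,k})$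 for some $\boldsymbol{\theta}_0\in\mathbb{R}^q$ and $F_0\in\mathbf{F}$, where $\mathbf{F}$ is the set of $F:\mathbb{R}^2\to(0,1)$ with $F(x,y)=1-F(y,x)$, strictly decreasing in the first and strictly increasing in the second argument. **Closed null.** For $\boldsymbol{r}$ without ties let $\tilde E_{\boldsymbol{r}}=\{(j,\ell):(j,\ell)\in E,\ r_\ell<r_j\}$ (each edge oriented worse-versus-better) and $E_{\boldsymbol{r}}=\{((j,\ell),(i,k)):(j,\ell),(i,k)\in\tilde E_{\boldsymbol{r}},\ r_\ell\le r_k\le r_i\le r_j,\ (j,\ell)\ne(i,k)\}$. The closed null $\overline{H}_0$ on the probability vector $\boldsymbol{p}$ is: $p_{j,\ell}\le\frac12$ for all $(j,\ell)\in\tilde E_{\boldsymbol{r}}$, and $p_{j,\ell}\le p_{i,k}$ for all $((j,\ell),(i,k))\in E_{\boldsymbol{r}}$. $\boldsymbol{P}_0(\boldsymbol{r})$ is the set of distributions $P$ of the sample under which the outcomes $Y_{\ell,k,i}$, $(\ell,k)\in E$ (one orientation per edge), $i=1,\dots,n_{\ell,k}$, are mutually independent with $Y_{\ell,k,i}$ Bernoulli with success probability $p_{\ell,k}$, and whose probability vector $\boldsymbol{p}=(p_{\ell,k})_{(\ell,k)\in E}$ satisfies $\overline{H}_0$. **Statistic.** $\hat p_{\ell,k}=\frac1{n_{\ell,k}}\sum_iY_{\ell,k,i}$, and $\hat{\boldsymbol{p}}^*$ is the maximizer of the Bernoulli log-likelihood subject to $\overline{H}_0$; equivalently $\hat{\boldsymbol{p}}^*=\arg\min_{\boldsymbol{p}:\overline{H}_0}\sum_{(\ell,k)\in\tilde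 E_{\boldsymbol{r}}}n_{\ell,k}(\hat p_{\ell,k}-p_{\ell,k})^2$. The likelihood ratio statistic is $$\Lambda=\Lambda(\hat{\boldsymbol{p}})=2\sum_{(\ell,k)\in\tilde E_{\boldsymbol{r}}}n_{\ell,k}\Big(\hat p_{\ell,k}\ln\frac{\hat p_{\ell,k}}{\hat p^*_{\ell,k}}+(1-\hat p_{\ell,k})\ln\frac{1-\hat p_{\ell,k}}{1-\hat p^*_{\ell,k}}\Big),$$ with conventions $0\ln(0/x)=0$ for $x\ge0$ and $x\ln(x/0)=\infty$ for $x>0$. **p-value.** For $\lambda$ in the range of $\Lambda$, $\pi_\lambda=\sup_{\boldsymbol{p}:\ \overline{H}_0}P_{\boldsymbol{p}}\{\Lambda\ge\lambda\}$, where $P_{\boldsymbol{p}}$ is the law of the data with probability vector $\boldsymbol{p}$ (same $G,\boldsymbol{n},\boldsymbol{r}$). *)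

theory Defs
  imports "HOL-Probability.Probability"
begin

definition simple_graph :: "nat \<Rightarrow> nat set set \<Rightarrow> bool" where
  "simple_graph q E \<longleftrightarrow> (\<forall>e\<in>E. e \<subseteq> {1..q} \<and> card e = 2)"

definition rankings :: "nat \<Rightarrow> (nat \<Rightarrow> nat) set" where
  "rankings q = {r. \<forall>l\<in>{1..q}. r l = 1 + (\<Sum>k\<in>{1..q}. of_bool (r k < r l))}"

definition without_ties :: "nat \<Rightarrow> (nat \<Rightarrow> nat) \<Rightarrow> bool" where
  "without_ties q r \<longleftrightarrow> inj_on r {1..q}"


text \<open>The pair \<open>(j, l)\<close> is the edge \<open>{j, l}\<close> read as worse team \<open>j\<close> versus better team \<open>l\<close>.\<close>

definition oriented_edges :: "nat set set \<Rightarrow> (nat \<Rightarrow> nat) \<Rightarrow> (nat \<times> nat) set" where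
  "oriented_edges E r = {(j, l). {j, l} \<in> E \<and> r l < r j}"

definition edge_order ::
    "nat set set \<Rightarrow> (nat \<Rightarrow> nat) \<Rightarrow> ((nat \<times> nat) \<times> (nat \<times> nat)) set" where
  "edge_order E r = {((j, l), (i, k)). (j, l) \<in> oriented_edges E r \<and> (i, k) \<in> oriented_edges E r \<and>
      r l \<le> r k \<and> r k \<le> r i \<and> r i \<le> r j \<and> (j, l) \<noteq> (i, k)}"

definition prob_vector :: "nat set set \<Rightarrow> (nat \<Rightarrow> nat \<Rightarrow> real) \<Rightarrow> bool" where
  "prob_vector E p \<longleftrightarrow> (\<forall>l k. {l, k} \<in> E \<longrightarrow> 0 \<le> p l k \<and> p l k \<le> 1 \<and> p k l = 1 - p l k)"

definition closed_null :: "nat set set \<Rightarrow> (nat \<Rightarrow> nat) \<Rightarrow> (nat \<Rightarrow> nat \<Rightarrow> real) \<Rightarrow> bool" where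
  "closed_null E r p \<longleftrightarrow> prob_vector E p \<and>
     (\<forall>(j, l)\<in>oriented_edges E r. p j l \<le> 1 / 2) \<and>
     (\<forall>((j, l), (i, k))\<in>edge_order E r. p j l \<le> p i k)"


text \<open>
  Sample sizes \<open>n\<close> are indexed by the unordered edge. A sample \<open>y\<close> records each edge in one
  orientation only, the one with \<open>l < k\<close>: \<open>y (l, k, i)\<close> says that \<open>l\<close> wins the \<open>i\<close>-th meeting with
  \<open>k\<close>, and \<open>y\<close> is \<open>False\<close> off the index set. The function \<open>outcome\<close> gives the 0/1 outcomes for both
  orientations.
\<close>

definition sample_index :: "nat set set \<Rightarrow> (nat set \<Rightarrow> nat) \<Rightarrow> (nat \<times> nat \<times> nat) set" where
  "sample_index E n = {(l, k, i). {l, k} \<in> E \<and> l < k \<and> i \<in> {1..n {l, k}}}"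

type_synonym sample = "nat \<times> nat \<times> nat \<Rightarrow> bool"

definition samples :: "nat set set \<Rightarrow> (nat set \<Rightarrow> nat) \<Rightarrow> sample set" where
  "samples E n = PiE_dflt (sample_index E n) False (\<lambda>_. UNIV)"

definition outcome :: "sample \<Rightarrow> nat \<Rightarrow> nat \<Rightarrow> nat \<Rightarrow> real" where
  "outcome y l k i = (if l < k then of_bool (y (l, k, i)) else 1 - of_bool (y (k, l, i)))"

definition bernoulli_sample ::
    "nat set set \<Rightarrow> (nat set \<Rightarrow> nat) \<Rightarrow> (nat \<Rightarrow> nat \<Rightarrow> real) \<Rightarrow> sample pmf \<Rightarrow> bool" where
  "bernoulli_sample E n p P \<longleftrightarrow>
     set_pmf P \<subseteq> samples E n \<and>
     prob_space.indep_vars (measure_pmf P) (\<lambda>_. count_space UNIV) (\<lambda>s y. y s) (sample_index E n) \<and>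
     (\<forall>(l, k, i)\<in>sample_index E n. map_pmf (\<lambda>y. y (l, k, i)) P = bernoulli_pmf (p l k))"

definition null_laws ::
    "nat set set \<Rightarrow> (nat set \<Rightarrow> nat) \<Rightarrow> (nat \<Rightarrow> nat) \<Rightarrow> sample pmf set" where
  "null_laws E n r = {P. \<exists>p. closed_null E r p \<and> bernoulli_sample E n p P}"

definition sample_law ::
    "nat set set \<Rightarrow> (nat set \<Rightarrow> nat) \<Rightarrow> (nat \<Rightarrow> nat \<Rightarrow> real) \<Rightarrow> sample pmf" where
  "sample_law E n p = Pi_pmf (sample_index E n) False (\<lambda>(l, k, i). bernoulli_pmf (p l k))"

definition phat :: "(nat set \<Rightarrow> nat) \<Rightarrow> sample \<Rightarrow> nat \<Rightarrow> nat \<Rightarrow> real" where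
  "phat n y l k = (\<Sum>i\<in>{1..n {l, k}}. outcome y l k i) / real (n {l, k})"


text \<open>
  The two functions below are only meant for nonnegative arguments. In the first, \<open>0 ln 0 = 0\<close> and
  \<open>x ln 0 = -\<infinity>\<close> for \<open>x > 0\<close>; in the second, \<open>0 ln (0/y) = 0\<close> and \<open>x ln (x/0) = \<infinity>\<close> for \<open>x > 0\<close>.
\<close>

definition xln :: "real \<Rightarrow> real \<Rightarrow> ereal" where
  "xln x y = (if x = 0 then 0 else if y = 0 then - \<infinity> else ereal (x * ln y))"

definition xln_quot :: "real \<Rightarrow> real \<Rightarrow> ereal" where
  "xln_quot x y = (if x = 0 then 0 else if y = 0 then \<infinity> else ereal (x * ln (x / y)))"

definition log_likelihood ::
    "nat set set \<Rightarrow> (nat set \<Rightarrow> nat) \<Rightarrow> (nat \<Rightarrow> nat) \<Rightarrow> (nat \<Rightarrow> nat \<Rightarrow> real) \<Rightarrow>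
      (nat \<Rightarrow> nat \<Rightarrow> real) \<Rightarrow> ereal" where
  "log_likelihood E n r ph p =
     (\<Sum>(l, k)\<in>oriented_edges E r.
        ereal (real (n {l, k})) * (xln (ph l k) (p l k) + xln (1 - ph l k) (1 - p l k)))"

text \<open>
  The constrained maximizer is unique as a function on the edges (for positive \<open>n\<close> the
  log-likelihood is strictly concave there), while its values off the edges are arbitrary; the statistic below only uses
  values on edges.
\<close>

definition constrained_mle ::
    "nat set set \<Rightarrow> (nat set \<Rightarrow> nat) \<Rightarrow> (nat \<Rightarrow> nat) \<Rightarrow> (nat \<Rightarrow> nat \<Rightarrow> real) \<Rightarrow>
      nat \<Rightarrow> nat \<Rightarrow> real" where
  "constrained_mle E n r ph = arg_max (log_likelihood E n r ph) (closed_null E r)"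

definition LR ::
    "nat set set \<Rightarrow> (nat set \<Rightarrow> nat) \<Rightarrow> (nat \<Rightarrow> nat) \<Rightarrow> (nat \<Rightarrow> nat \<Rightarrow> real) \<Rightarrow> ereal" where
  "LR E n r ph =
     2 * (\<Sum>(l, k)\<in>oriented_edges E r. ereal (real (n {l, k})) *
        (xln_quot (ph l k) (constrained_mle E n r ph l k) +
         xln_quot (1 - ph l k) (1 - constrained_mle E n r ph l k)))"

definition p_value :: "nat set set \<Rightarrow> (nat set \<Rightarrow> nat) \<Rightarrow> (nat \<Rightarrow> nat) \<Rightarrow> ereal \<Rightarrow> real" where
  "p_value E n r lam =
     (SUP p\<in>{p. closed_null E r p}.
        measure_pmf.prob (sample_law E n p) {y. lam \<le> LR E n r (phat n y)})"

definition fs_test ::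
    "nat set set \<Rightarrow> (nat set \<Rightarrow> nat) \<Rightarrow> (nat \<Rightarrow> nat) \<Rightarrow> real \<Rightarrow> sample \<Rightarrow> real" where
  "fs_test E n r \<alpha> y = of_bool (p_value E n r (LR E n r (phat n y)) \<le> \<alpha>)"


text \<open>
  Link functions, and two facts relating them to the null: a link model whose scores are ordered
  as \<open>r\<close> satisfies the closed null, and the product law of any null vector is a null law.
\<close>

definition link_functions :: "(real \<Rightarrow> real \<Rightarrow> real) set" where
  "link_functions = {F. (\<forall>x y. 0 < F x y \<and> F x y < 1 \<and> F x y = 1 - F y x) \<and>
     (\<forall>x x' y. x < x' \<longrightarrow> F x' y < F x y) \<and> (\<forall>x y y'. y < y' \<longrightarrow> F x y < F x y')}"

lemma finite_sample_index:
  assumes "simple_graph q E"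
  shows "finite (sample_index E n)"
proof -
  have "E \<subseteq> Pow {1..q}" using assms by (auto simp: simple_graph_def)
  then have fE: "finite E" by (rule finite_subset) simp
  have V: "l \<in> {1..q} \<and> k \<in> {1..q}" if "{l, k} \<in> E" for l k
  proof -
    have "{l, k} \<subseteq> {1..q}"
      using assms that by (simp add: simple_graph_def del: insert_subset)
    then show ?thesis by simp
  qed
  have "sample_index E n \<subseteq> {1..q} \<times> {1..q} \<times> (\<Union>e\<in>E. {1..n e})"
  proof
    fix s assume "s \<in> sample_index E n"
    then obtain l k i where "s = (l, k, i)" "{l, k} \<in> E" "i \<in> {1..n {l, k}}"
      by (auto simp: sample_index_def)
    with V[of l k] show "s \<in> {1..q} \<times> {1..q} \<times> (\<Union>e\<in>E. {1..n e})"
      by (simp del: atLeastAtMost_iff) (rule bexI)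
  qed
  then show ?thesis by (rule finite_subset) (intro finite_cartesian_product finite_UN_I fE finite_atLeastAtMost)
qed

lemma sample_law_null_laws:
  assumes "simple_graph q E" and "closed_null E r p"
  shows "sample_law E n p \<in> null_laws E n r"
proof -
  have fin: "finite (sample_index E n)" by (rule finite_sample_index[OF assms(1)])
  have "bernoulli_sample E n p (sample_law E n p)"
    unfolding bernoulli_sample_def
  proof (intro conjI)
    show "set_pmf (sample_law E n p) \<subseteq> samples E n"
      using fin by (auto simp: sample_law_def samples_def set_Pi_pmf PiE_dflt_def)
    show "prob_space.indep_vars (measure_pmf (sample_law E n p)) (\<lambda>_. count_space UNIV)
        (\<lambda>s y. y s) (sample_index E n)"
      unfolding sample_law_def by (rule indep_vars_Pi_pmf[OF fin])
    show "\<forall>(l, k, i)\<in>sample_index E n.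
        map_pmf (\<lambda>y. y (l, k, i)) (sample_law E n p) = bernoulli_pmf (p l k)"
      unfolding sample_law_def by (auto simp: Pi_pmf_component[OF fin])
  qed
  with assms(2) show ?thesis by (auto simp: null_laws_def)
qed

lemma link_closed_null:
  assumes E: "simple_graph q E" and F: "F \<in> link_functions"
    and ord: "\<And>l k. l \<in> {1..q} \<Longrightarrow> k \<in> {1..q} \<Longrightarrow> r l \<le> r k \<longleftrightarrow> \<theta> l \<le> \<theta> k"
  shows "closed_null E r (\<lambda>l k. F (\<theta> l) (\<theta> k))"
proof -
  have dec: "F x' y < F x y" if "x < x'" for x x' y
    using F that unfolding link_functions_def by blast
  have inc: "F x y < F x y'" if "y < y'" for x y y'
    using F that unfolding link_functions_def by blast
  have rng: "0 < F x y" "F x y < 1" and compl: "F x y = 1 - F y x" for x y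
    using F unfolding link_functions_def by blast+
  have mono: "F x y \<le> F x' y'" if "x' \<le> x" "y \<le> y'" for x y x' y'
  proof -
    have "F x y \<le> F x' y" using dec[of x' x y] that(1) by (cases "x' = x") auto
    also have "F x' y \<le> F x' y'" using inc[of y y' x'] that(2) by (cases "y = y'") auto
    finally show ?thesis .
  qed
  have diag: "F x x = 1 / 2" for x
    using compl[of x x] by linarith
  have V: "j \<in> {1..q}" "l \<in> {1..q}" if "(j, l) \<in> oriented_edges E r" for j l
  proof -
    have "{j, l} \<subseteq> {1..q}"
      using that E by (simp add: oriented_edges_def simple_graph_def del: insert_subset)
    then show "j \<in> {1..q}" "l \<in> {1..q}" by simp_all
  qed
  have "prob_vector E (\<lambda>l k. F (\<theta> l) (\<theta> k))"
    unfolding prob_vector_def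
    by (intro allI impI conjI) (rule less_imp_le[OF rng(1)] less_imp_le[OF rng(2)] compl)+
  moreover have "F (\<theta> j) (\<theta> l) \<le> 1 / 2" if "(j, l) \<in> oriented_edges E r" for j l
  proof -
    have "\<theta> l \<le> \<theta> j" using that ord[OF V(2)[OF that] V(1)[OF that]] by (simp add: oriented_edges_def)
    then show ?thesis using mono[of "\<theta> l" "\<theta> j" "\<theta> l" "\<theta> l"] diag by simp
  qed
  moreover have "F (\<theta> j) (\<theta> l) \<le> F (\<theta> i) (\<theta> k)" if "((j, l), (i, k)) \<in> edge_order E r" for j l i k
  proof -
    have e: "(j, l) \<in> oriented_edges E r" "(i, k) \<in> oriented_edges E r" "r l \<le> r k" "r i \<le> r j"
      using that by (simp_all add: edge_order_def)
    then have "\<theta> l \<le> \<theta> k" "\<theta> i \<le> \<theta> j"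
      using ord[OF V(2)[OF e(1)] V(2)[OF e(2)]] ord[OF V(1)[OF e(2)] V(1)[OF e(1)]] by simp_all
    then show ?thesis by (intro mono)
  qed
  ultimately show ?thesis
    unfolding closed_null_def by (intro conjI ballI) (simp_all add: split_paired_all)
qed

end

theory Submission imports Defs begin

text \<open>
  A law of the sample is determined by independence and its marginals. The sample space is
  finite, so if the rejection event is nonempty, some sample \<open>y0\<close> in it has the smallest statistic;
  the rejection event then implies \<open>\<Lambda> \<ge> \<Lambda>(y0)\<close>, whose null probability is at most the p-value at
  \<open>y0\<close>, hence at most \<open>\<alpha>\<close>.
\<close>

text \<open>The support condition fixes every coordinate outside \<open>I\<close>, so a point mass
  of \<open>P\<close> is the probability of a cylinder over \<open>I\<close>, and independence
  factors it into the marginals.\<close>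

lemma indep_eq_Pi_pmf:
  fixes P :: "('a \<Rightarrow> 'b) pmf"
  assumes fin: "finite I"
    and supp: "set_pmf P \<subseteq> PiE_dflt I d (\<lambda>_. UNIV)"
    and indep: "prob_space.indep_vars (measure_pmf P) (\<lambda>_. count_space UNIV) (\<lambda>s y. y s) I"
    and marg: "\<And>s. s \<in> I \<Longrightarrow> map_pmf (\<lambda>y. y s) P = M s"
  shows "P = Pi_pmf I d M"
proof (rule pmf_eqI)
  fix y
  have off: "x s = d" if "x \<in> set_pmf P" "s \<notin> I" for x s
    using supp that by (auto simp: PiE_dflt_def)
  show "pmf P y = pmf (Pi_pmf I d M) y"
  proof (cases "\<forall>s. s \<notin> I \<longrightarrow> y s = d")
    case True
    have "pmf P y = measure_pmf.prob P {x. \<forall>s\<in>I. x s = y s}"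
    proof -
      \<comment> \<open>The cylinder and \<open>{y}\<close> agree only inside the support; this
        suffices, as intersecting with the support keeps probabilities.\<close>
      have "{x. \<forall>s\<in>I. x s = y s} \<inter> set_pmf P = {y} \<inter> set_pmf P"
        using off True by (fastforce simp: fun_eq_iff)
      from arg_cong[OF this, of "measure_pmf.prob P"] show ?thesis
        by (simp only: measure_Int_set_pmf measure_pmf_single)
    qed
    also have "\<dots> = (\<Prod>s\<in>I. measure_pmf.prob P ((\<lambda>x. x s) -` {y s}))"
    \<comment> \<open>The product rule for independent variables is applied with a nonempty index
      set; for empty \<open>I\<close> both sides are 1.\<close>
    proof (cases "I = {}")
      case False
      then have "measure_pmf.prob P (\<Inter>s\<in>I. (\<lambda>x. x s) -` {y s}) =
          (\<Prod>s\<in>I. measure_pmf.prob P ((\<lambda>x. x s) -` {y s}))"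
        using prob_space.indep_varsD_finite[OF measure_pmf.prob_space_axioms indep _ fin,
            of "\<lambda>s. {y s}"]
        by simp
      moreover have "{x. \<forall>s\<in>I. x s = y s} = (\<Inter>s\<in>I. (\<lambda>x. x s) -` {y s})"
        by auto
      ultimately show ?thesis by simp
    qed simp
    also have "\<dots> = (\<Prod>s\<in>I. pmf (M s) (y s))"
      by (intro prod.cong refl) (simp add: marg[symmetric] pmf_map)
    also have "\<dots> = pmf (Pi_pmf I d M) y"
      using True by (simp add: pmf_Pi[OF fin])
    finally show ?thesis .
  next
    case False
    then have "y \<notin> set_pmf P" using off by blast
    with False show ?thesis by (auto simp: pmf_Pi[OF fin] set_pmf_iff)
  qed
qed

text \<open>Links \<open>null_laws\<close>, given by independence and marginals, to the product law
  over which \<open>p_value\<close> takes its supremum.\<close>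

lemma bernoulli_sample_eq_sample_law:
  assumes "simple_graph q E" and "bernoulli_sample E n p P"
  shows "P = sample_law E n p"
  unfolding sample_law_def
  by (rule indep_eq_Pi_pmf[OF finite_sample_index[OF assms(1)]])
    (use assms(2) in \<open>auto simp: bernoulli_sample_def samples_def\<close>)

text \<open>The bound on the tails is the only link between \<open>\<pi>\<close> and
  \<open>T\<close>: \<open>\<pi>\<close> may fail to be monotone, since the tail at the least value
  of \<open>T\<close> already covers the event.\<close>

lemma prob_p_value_le:
  fixes T :: "'a \<Rightarrow> 'b :: linorder" and \<pi> :: "'b \<Rightarrow> real"
  assumes fin: "finite (set_pmf P)" and "0 \<le> \<alpha>"
    and tail: "\<And>t. measure_pmf.prob P {y. t \<le> T y} \<le> \<pi> t"
  shows "measure_pmf.prob P {y. \<pi> (T y) \<le> \<alpha>} \<le> \<alpha>"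
proof -
  \<comment> \<open>Cutting down to the support makes the event finite, so that \<open>T\<close>
    attains a minimum on it, without changing its probability.\<close>
  define B where "B = {y. \<pi> (T y) \<le> \<alpha>} \<inter> set_pmf P"
  have "measure_pmf.prob P B \<le> \<alpha>"
  proof (cases "B = {}")
    case False
    have "finite B" using fin by (simp add: B_def)
    then obtain y0 where y0: "y0 \<in> B" "\<And>y. y \<in> B \<Longrightarrow> T y0 \<le> T y"
      using ex_min_if_finite[of "T ` B"] False by (auto simp: not_less)
    have "measure_pmf.prob P B \<le> measure_pmf.prob P {y. T y0 \<le> T y}"
      by (intro measure_pmf.finite_measure_mono) (use y0 in auto)
    also have "\<dots> \<le> \<pi> (T y0)" by (rule tail)
    also have "\<dots> \<le> \<alpha>" using y0 by (simp add: B_def)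
    finally show ?thesis .
  qed (simp add: \<open>0 \<le> \<alpha>\<close>)
  then show ?thesis by (simp add: B_def measure_Int_set_pmf)
qed

text \<open>\<open>p\<close> is itself a competitor in the supremum, which is a real number because
  probabilities are bounded by 1.\<close>

lemma prob_le_p_value:
  assumes "closed_null E r p"
  shows "measure_pmf.prob (sample_law E n p) {y. t \<le> LR E n r (phat n y)} \<le> p_value E n r t"
  unfolding p_value_def
  by (rule cSUP_upper) (use assms in \<open>auto intro!: bdd_aboveI2[where M = 1]\<close>)

theorem theorem3:
  fixes q :: nat and E :: "nat set set" and r :: "nat \<Rightarrow> nat" and \<alpha> :: real
  assumes "simple_graph q E"
    and "r \<in> rankings q" and "without_ties q r"
    and "0 < \<alpha>" and "\<alpha> < 1"
  shows "\<forall>n :: nat set \<Rightarrow> nat. (\<forall>e\<in>E. 0 < n e) \<longrightarrow>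
    (\<forall>P\<in>null_laws E n r. measure_pmf.expectation P (fs_test E n r \<alpha>) \<le> \<alpha>)"
proof (intro allI impI ballI)
  fix n :: "nat set \<Rightarrow> nat" and P
  assume "P \<in> null_laws E n r"
  then obtain p where p: "closed_null E r p" "bernoulli_sample E n p P"
    by (auto simp: null_laws_def)
  have P: "P = sample_law E n p"
    by (rule bernoulli_sample_eq_sample_law[OF assms(1) p(2)])
  have "finite (samples E n)"
    unfolding samples_def by (intro finite_PiE_dflt finite_sample_index[OF assms(1)]) simp
  then have fin: "finite (set_pmf P)"
    using p(2) by (auto simp: bernoulli_sample_def intro: finite_subset)
  have "fs_test E n r \<alpha> = indicator {y. p_value E n r (LR E n r (phat n y)) \<le> \<alpha>}"
    by (auto simp: fs_test_def fun_eq_iff indicator_def)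
  then have "measure_pmf.expectation P (fs_test E n r \<alpha>) =
      measure_pmf.prob P {y. p_value E n r (LR E n r (phat n y)) \<le> \<alpha>}"
    by simp
  also have "\<dots> \<le> \<alpha>"
    \<comment> \<open>Here \<open>T\<close> is the statistic with values in \<open>ereal\<close>;
      only its linear order matters, so infinite values do no harm.\<close>
    by (rule prob_p_value_le[OF fin]) (use assms(4) prob_le_p_value[OF p(1)] P in auto)
  finally show "measure_pmf.expectation P (fs_test E n r \<alpha>) \<le> \<alpha>" .
qed

end
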